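(* Let $P$ be a reflexive cone of a Banach space $X$. If $P$ has a bounded base defined by some $x^*\in X^*$, then $P$ does not contain a basic sequence.
   Context: All spaces are real. $B_X$ is the closed unit ball of $X$. A cone of $X$ is a nonempty convex set $P\subseteq X$ with $\lambda P\subseteq P$ for every real $\lambda\ge 0$. A cone $P$ of a Banach space $X$ is reflexive if $P\cap B_X$ is weakly compact. A functional $x^*\in X^*$ is strictly positive on $P$ if $x^*(x)>0$ for each $x\in P\setminus\{0\}$; in that case the base for $P$ defined by $x^*$ is $B_{x^*}=\{x\in P: x^*(x)=1\}$. Saying that $P$ has a base defined by $x^*$ means that $x^*$ is strictly positive on $P$ and the base is $B_{x^*}$. A basic sequence is a sequence that is a Schauder basis of its closed linear span; $P$ contains a basic sequence if all terms of some basic sequence of $X$ lie in $P$. *)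

theory Defs
  imports "HOL-Analysis.Analysis"
begin

definition weak_topology :: "'a::real_normed_vector topology" where
  "weak_topology =
     topology_generated_by
       {blinfun_apply f -` U | (f :: 'a \<Rightarrow>\<^sub>L real) U. open U}"

(* Convexity, nonemptiness and closure under multiplication by nonnegative scalars are
   the library's convex_cone. No closedness of P is required beyond weak compactness
   of its intersection with the unit ball. *)
definition reflexive_cone :: "'a::banach set \<Rightarrow> bool" where
  "reflexive_cone P \<longleftrightarrow> convex_cone P \<and> compactin weak_topology (P \<inter> cball 0 1)"

definition strictly_positive_on ::
    "'a::real_normed_vector set \<Rightarrow> ('a \<Rightarrow>\<^sub>L real) \<Rightarrow> bool" where
  "strictly_positive_on P f \<longleftrightarrow> (\<forall>x\<in>P - {0}. blinfun_apply f x > 0)"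

definition cone_base ::
    "'a::real_normed_vector set \<Rightarrow> ('a \<Rightarrow>\<^sub>L real) \<Rightarrow> 'a set" where
  "cone_base P f = {x \<in> P. blinfun_apply f x = 1}"

definition has_bounded_base_by ::
    "'a::real_normed_vector set \<Rightarrow> ('a \<Rightarrow>\<^sub>L real) \<Rightarrow> bool" where
  "has_bounded_base_by P f \<longleftrightarrow> strictly_positive_on P f \<and> bounded (cone_base P f)"

(* The sums clause is norm convergence of the partial sums in the given order. *)
definition schauder_basis_of ::
    "(nat \<Rightarrow> 'a::real_normed_vector) \<Rightarrow> 'a set \<Rightarrow> bool" where
  "schauder_basis_of e Y \<longleftrightarrow>
     range e \<subseteq> Y \<and>
     (\<forall>y\<in>Y. \<exists>!c :: nat \<Rightarrow> real. (\<lambda>n. c n *\<^sub>R e n) sums y)"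

definition basic_sequence :: "(nat \<Rightarrow> 'a::real_normed_vector) \<Rightarrow> bool" where
  "basic_sequence e \<longleftrightarrow> schauder_basis_of e (closure (span (range e)))"

definition contains_basic_sequence :: "'a::real_normed_vector set \<Rightarrow> bool" where
  "contains_basic_sequence P \<longleftrightarrow> (\<exists>e. basic_sequence e \<and> range e \<subseteq> P)"

end

theory Submission
  imports Defs
begin

text \<open>
  Suppose that the cone \<open>P\<close> contains a basic sequence \<open>e\<close>, and let \<open>f\<close> define a base of norm at
  most \<open>M\<close>. Strict positivity allows each \<open>e n\<close> to be rescaled to a vector \<open>w n\<close> of \<open>P\<close> with
  \<open>f (w n) = 1 / M\<close>, and boundedness of the base says that \<open>w n\<close> lies in the unit ball. By weak
  compactness of \<open>P \<inter> cball 0 1\<close> the sequence \<open>w\<close> has a weak cluster point \<open>x\<close>, and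
  \<open>f x = 1 / M\<close> because \<open>f\<close> is weakly continuous. Closed subspaces are weakly closed, so \<open>x\<close> lies
  in the closed span of every tail of \<open>e\<close>. For a basic sequence these closed spans intersect in
  \<open>0\<close> only, hence \<open>x = 0\<close> and \<open>f x = 0\<close>, a contradiction.

  Two classical theorems carry this argument. The fact that closed subspaces are weakly closed
  (\<open>closedin_weak_topology_closed_subspace\<close>) needs a functional that vanishes on the subspace and
  not at a given outside point; it comes from the Hahn-Banach theorem, applied to the distance to
  the subspace. Hahn-Banach itself is obtained from a minimal sublinear functional below the given
  one: minimality forces linearity, so no extension of partially defined functionals is required.

  The triviality of the intersection of the tails (\<open>tail_spans_intersect_trivially\<close>) rests on
  Banach's theorem that the partial sum operators of a Schauder basis are uniformly bounded
  (\<open>partial_sum_uniformly_bounded\<close>): these operators vanish on the spans of late tails, by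
  continuity also on their closures, while they converge pointwise to the identity. The uniform
  bound follows from the Baire category theorem and an open-mapping type successive approximation.
\<close>

section \<open>The Hahn-Banach theorem through minimal sublinear functionals\<close>

definition sublinear :: "('a::real_vector \<Rightarrow> real) \<Rightarrow> bool" where
  "sublinear p \<longleftrightarrow> (\<forall>x y. p (x + y) \<le> p x + p y) \<and> (\<forall>c\<ge>0. \<forall>x. p (c *\<^sub>R x) = c * p x)"

lemma sublinear_add: "sublinear p \<Longrightarrow> p (x + y) \<le> p x + p y"
  and sublinear_scaleR: "sublinear p \<Longrightarrow> 0 \<le> c \<Longrightarrow> p (c *\<^sub>R x) = c * p x"
  by (auto simp: sublinear_def)

lemma sublinear_zero: "sublinear p \<Longrightarrow> p 0 = 0"
  using sublinear_scaleR[of p 0 0] by simp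

lemma sublinear_minus: "sublinear p \<Longrightarrow> - p (- x) \<le> p x"
  using sublinear_add[of p x "- x"] sublinear_zero[of p] by simp

text \<open>Applying the upper bound for \<open>c\<close> and for \<open>inverse c\<close> gives equality in the scaling law.\<close>

lemma sublinearI:
  assumes add: "\<And>x y. p (x + y) \<le> p x + p y"
    and scale: "\<And>c x. 0 < c \<Longrightarrow> p (c *\<^sub>R x) \<le> c * p x"
    and zero: "p 0 = 0"
  shows "sublinear p"
proof -
  have "p (c *\<^sub>R x) = c * p x" if "0 \<le> c" for c x
  proof (cases "c = 0")
    case False
    then have c: "0 < c" using that by simp
    have "p (inverse c *\<^sub>R c *\<^sub>R x) \<le> inverse c * p (c *\<^sub>R x)"
      using scale[of "inverse c" "c *\<^sub>R x"] c by simp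
    then have "c * p x \<le> p (c *\<^sub>R x)"
      using c by (simp add: field_simps)
    then show ?thesis using scale[OF c, of x] by simp
  qed (simp add: zero)
  then show ?thesis using add by (simp add: sublinear_def)
qed

text \<open>The functional \<open>shifted p z\<close> is the largest sublinear functional below \<open>p\<close> whose value at
  \<open>- z\<close> is at most \<open>- p z\<close>. It serves twice: to show that a minimal functional is odd, and to
  prescribe the value of the Hahn-Banach functional at one point.\<close>

definition shifted :: "('a::real_vector \<Rightarrow> real) \<Rightarrow> 'a \<Rightarrow> 'a \<Rightarrow> real" where
  "shifted p z y = (INF t\<in>{0..}. p (y + t *\<^sub>R z) - t * p z)"

lemma shifted_term_bound:
  assumes "sublinear p" "0 \<le> t"
  shows "- p (- y) \<le> p (y + t *\<^sub>R z) - t * p z"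
  using sublinear_add[OF assms(1), of "y + t *\<^sub>R z" "- y"] sublinear_scaleR[OF assms, of z] by simp

lemma shifted_le_term:
  assumes "sublinear p" "0 \<le> t"
  shows "shifted p z y \<le> p (y + t *\<^sub>R z) - t * p z"
  unfolding shifted_def
proof (rule cINF_lower)
  show "bdd_below ((\<lambda>t. p (y + t *\<^sub>R z) - t * p z) ` {0..})"
    using shifted_term_bound[OF assms(1)] by (intro bdd_belowI[of _ "- p (- y)"]) auto
qed (use assms in simp)

lemma le_shifted:
  assumes "\<And>t. 0 \<le> t \<Longrightarrow> b \<le> p (y + t *\<^sub>R z) - t * p z"
  shows "b \<le> shifted p z y"
  unfolding shifted_def by (rule cINF_greatest) (use assms in auto)

lemma shifted_le: "sublinear p \<Longrightarrow> shifted p z y \<le> p y"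
  using shifted_le_term[of p 0 z y] by simp

lemma shifted_minus_le: "sublinear p \<Longrightarrow> shifted p z (- z) \<le> - p z"
  using shifted_le_term[of p 1 z "- z"] sublinear_zero[of p] by simp

text \<open>The terms of the infima at \<open>x\<close> and \<open>y\<close> with parameters \<open>s\<close> and \<open>t\<close> add up to a bound for the
  term at \<open>x + y\<close> with parameter \<open>s + t\<close>; the parameter at \<open>c *\<^sub>R x\<close> is \<open>c\<close> times the one at \<open>x\<close>.\<close>

lemma sublinear_shifted:
  assumes p: "sublinear p"
  shows "sublinear (shifted p z)"
proof (rule sublinearI)
  fix x y
  have *: "shifted p z (x + y) \<le> (p (x + s *\<^sub>R z) - s * p z) + (p (y + t *\<^sub>R z) - t * p z)"
    if "0 \<le> s" "0 \<le> t" for s t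
    using shifted_le_term[OF p, of "s + t" z "x + y"] that
      sublinear_add[OF p, of "x + s *\<^sub>R z" "y + t *\<^sub>R z"]
    by (simp add: algebra_simps)
  have "shifted p z (x + y) - (p (x + s *\<^sub>R z) - s * p z) \<le> shifted p z y" if "0 \<le> s" for s
    by (rule le_shifted) (use *[OF that] in \<open>simp add: algebra_simps\<close>)
  then have "shifted p z (x + y) - shifted p z y \<le> shifted p z x"
    by (intro le_shifted) (simp add: algebra_simps)
  then show "shifted p z (x + y) \<le> shifted p z x + shifted p z y"
    by simp
next
  fix c :: real and x
  assume c: "0 < c"
  have "inverse c * shifted p z (c *\<^sub>R x) \<le> shifted p z x"
  proof (rule le_shifted)
    fix t :: real assume t: "0 \<le> t"
    have "shifted p z (c *\<^sub>R x) \<le> p (c *\<^sub>R x + (c * t) *\<^sub>R z) - (c * t) * p z"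
      using shifted_le_term[OF p, of "c * t" z "c *\<^sub>R x"] c t by simp
    also have "\<dots> = c * (p (x + t *\<^sub>R z) - t * p z)"
      using sublinear_scaleR[OF p, of c "x + t *\<^sub>R z"] c by (simp add: algebra_simps)
    finally show "inverse c * shifted p z (c *\<^sub>R x) \<le> p (x + t *\<^sub>R z) - t * p z"
      using c by (simp add: field_simps)
  qed
  then show "shifted p z (c *\<^sub>R x) \<le> c * shifted p z x"
    using c by (simp add: field_simps)
next
  have "0 \<le> shifted p z 0"
    by (rule le_shifted) (use sublinear_scaleR[OF p, of _ z] in simp)
  then show "shifted p z 0 = 0"
    using shifted_le[OF p, of z 0] sublinear_zero[OF p] by simp
qed

text \<open>Minimality makes \<open>m\<close> equal to each \<open>shifted m z\<close>, whence \<open>m (- z) \<le> - m z\<close>. A sublinear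
  functional that is odd is linear.\<close>

lemma linear_if_minimal_sublinear:
  assumes m: "sublinear m" and min: "\<And>r. sublinear r \<Longrightarrow> r \<le> m \<Longrightarrow> r = m"
  shows "linear m"
proof -
  have odd: "m (- z) = - m z" for z
  proof -
    have "shifted m z = m"
      using min[OF sublinear_shifted[OF m]] shifted_le[OF m] by (simp add: le_fun_def)
    then show ?thesis
      using shifted_minus_le[OF m, of z] sublinear_minus[OF m, of z] by simp
  qed
  show ?thesis
  proof (rule linearI)
    show "m (x + y) = m x + m y" for x y
      using sublinear_add[OF m, of x y] sublinear_add[OF m, of "- x" "- y"]
        odd[of "x + y"] odd[of x] odd[of y] by simp
    show "m (c *\<^sub>R x) = c *\<^sub>R m x" for c x
    proof (cases "0 \<le> c")
      case False
      then show ?thesis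
        using sublinear_scaleR[OF m, of "- c" x] odd[of "c *\<^sub>R x"] by simp
    qed (simp add: sublinear_scaleR[OF m])
  qed
qed

text \<open>A chain is what subadditivity of the infimum needs: two members that nearly attain it at \<open>x\<close> and at
  \<open>y\<close> can be replaced by the smaller of the two. The common upper bound \<open>p\<close> keeps the infima
  finite, since \<open>- p (- y) \<le> r y\<close> for every sublinear \<open>r \<le> p\<close>.\<close>

lemma sublinear_INF_chain:
  assumes C: "C \<noteq> {}" "\<And>r. r \<in> C \<Longrightarrow> sublinear r \<and> r \<le> p"
    and chain: "\<And>r s. r \<in> C \<Longrightarrow> s \<in> C \<Longrightarrow> r \<le> s \<or> s \<le> r"
  shows "sublinear (\<lambda>y. INF r\<in>C. r y)" and "\<And>r. r \<in> C \<Longrightarrow> (\<lambda>y. INF r\<in>C. r y) \<le> r"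
proof -
  let ?q = "\<lambda>y. INF r\<in>C. r y"
  have lower: "?q y \<le> r y" if "r \<in> C" for r y
  proof (rule cINF_lower[OF _ that])
    have "- p (- y) \<le> s y" if "s \<in> C" for s
      using sublinear_minus[of s y] C(2)[OF that] by (auto simp: le_fun_def intro: order_trans[rotated])
    then show "bdd_below ((\<lambda>r. r y) ` C)"
      by (intro bdd_belowI[of _ "- p (- y)"]) auto
  qed
  then show "\<And>r. r \<in> C \<Longrightarrow> ?q \<le> r" by (simp add: le_fun_def)
  have greatest: "b \<le> ?q y" if "\<And>r. r \<in> C \<Longrightarrow> b \<le> r y" for b y
    by (rule cINF_greatest[OF C(1)]) (rule that)
  show "sublinear ?q"
  proof (rule sublinearI)
    fix x y
    have *: "?q (x + y) \<le> r x + s y" if rs: "r \<in> C" "s \<in> C" for r s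
    proof -
      obtain u where u: "u \<in> C" "u \<le> r" "u \<le> s"
        using chain[OF rs] rs by blast
      have "?q (x + y) \<le> u x + u y"
        using lower[OF u(1), of "x + y"] sublinear_add[of u x y] C(2)[OF u(1)] by linarith
      then show ?thesis using u(2,3) by (meson add_mono le_funD order_trans)
    qed
    have "?q (x + y) - r x \<le> ?q y" if "r \<in> C" for r
      by (rule greatest) (use *[OF that] in \<open>simp add: algebra_simps\<close>)
    then have "?q (x + y) - ?q y \<le> ?q x"
      by (intro greatest) (simp add: algebra_simps)
    then show "?q (x + y) \<le> ?q x + ?q y" by simp
  next
    fix c :: real and x
    assume c: "0 < c"
    have "inverse c * ?q (c *\<^sub>R x) \<le> ?q x"
    proof (rule greatest)
      fix r assume r: "r \<in> C"
      have "?q (c *\<^sub>R x) \<le> c * r x"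
        using lower[OF r, of "c *\<^sub>R x"] sublinear_scaleR[of r c x] C(2)[OF r] c by simp
      then show "inverse c * ?q (c *\<^sub>R x) \<le> r x" using c by (simp add: field_simps)
    qed
    then show "?q (c *\<^sub>R x) \<le> c * ?q x" using c by (simp add: field_simps)
  next
    have "(\<lambda>r. r 0) ` C = {0}"
      using C sublinear_zero by force
    then show "?q 0 = 0" by simp
  qed
qed

lemma minimal_sublinear_exists:
  assumes p: "sublinear p"
  obtains m where "sublinear m" "m \<le> p" "\<And>r. sublinear r \<Longrightarrow> r \<le> m \<Longrightarrow> r = m"
proof -
  define A where "A = {r. sublinear r \<and> r \<le> p}"
  \<comment> \<open>Zorn for the reversed order, so that a maximal element is a minimal functional\<close>
  have "\<exists>m\<in>A. \<forall>r\<in>A. r \<le> m \<longrightarrow> r = m"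
  proof (rule predicate_Zorn)
    show "partial_order_on A (relation_of (\<lambda>x y. y \<le> x) A)"
      by (rule partial_order_on_relation_ofI) auto
    fix C assume "C \<in> Chains (relation_of (\<lambda>x y. y \<le> x) A)"
    then have CA: "C \<subseteq> A" and chain: "\<And>r s. r \<in> C \<Longrightarrow> s \<in> C \<Longrightarrow> r \<le> s \<or> s \<le> r"
      by (auto simp: Chains_def relation_of_def)
    show "\<exists>u\<in>A. \<forall>r\<in>C. u \<le> r"
    proof (cases "C = {}")
      case True
      then show ?thesis using p by (auto simp: A_def)
    next
      case False
      have C: "sublinear r \<and> r \<le> p" if "r \<in> C" for r
        using that CA by (auto simp: A_def)
      note q = sublinear_INF_chain[OF False C chain]
      obtain r where "r \<in> C" using False by blast
      then have "(\<lambda>y. INF r\<in>C. r y) \<le> p"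
        using q(2) C by (meson order_trans)
      then show ?thesis
        using q by (auto simp: A_def intro!: bexI[of _ "\<lambda>y. INF r\<in>C. r y"])
    qed
  qed
  then obtain m where "m \<in> A" "\<And>r. r \<in> A \<Longrightarrow> r \<le> m \<Longrightarrow> r = m" by blast
  then show thesis by (intro that[of m]) (auto simp: A_def intro: order_trans)
qed

text \<open>Starting from \<open>shifted p z\<close> instead of \<open>p\<close> yields \<open>g (- z) \<le> - p z\<close> and so, by linearity, the
  value \<open>p z\<close> at \<open>z\<close>.\<close>

theorem hahn_banach_sublinear:
  assumes p: "sublinear p"
  obtains g where "linear g" "\<And>x. g x \<le> p x" "g z = p z"
proof -
  obtain g where g: "sublinear g" "g \<le> shifted p z" "\<And>r. sublinear r \<Longrightarrow> r \<le> g \<Longrightarrow> r = g"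
    using minimal_sublinear_exists[OF sublinear_shifted[OF p]] by blast
  have lin: "linear g" using linear_if_minimal_sublinear g by blast
  have le: "g x \<le> p x" for x
    using g(2) shifted_le[OF p, of z x] by (meson le_funD order_trans)
  have "- g z \<le> - p z"
    using le_funD[OF g(2), of "- z"] shifted_minus_le[OF p, of z] linear_neg[OF lin, of z] by simp
  then show thesis using that lin le le[of z] by force
qed

lemma sublinear_infdist_subspace:
  fixes Z :: "'a::real_normed_vector set"
  assumes Z: "subspace Z"
  shows "sublinear (\<lambda>x. infdist x Z)"
proof -
  have ne: "Z \<noteq> {}" using subspace_0[OF Z] by blast
  have near: "\<exists>z\<in>Z. norm (x - z) < infdist x Z + e" if "0 < e" for x e
  proof -
    have "\<exists>z\<in>Z. dist x z < infdist x Z + e"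
      using cInf_lessD[of "dist x ` Z" "infdist x Z + e"] that ne by (simp add: infdist_notempty)
    then show ?thesis by (simp add: dist_norm)
  qed
  have le: "infdist x Z \<le> norm (x - z)" if "z \<in> Z" for x z
    using infdist_le[OF that, of x] by (simp add: dist_norm)
  show ?thesis
  proof (rule sublinearI)
    fix x y
    show "infdist (x + y) Z \<le> infdist x Z + infdist y Z"
    proof (rule field_le_epsilon)
      fix e :: real assume "0 < e"
      then obtain z w where zw: "z \<in> Z" "norm (x - z) < infdist x Z + e/2"
          "w \<in> Z" "norm (y - w) < infdist y Z + e/2"
        using near[of "e/2"] by (meson half_gt_zero)
      have "infdist (x + y) Z \<le> norm ((x + y) - (z + w))"
        using le subspace_add[OF Z] zw by blast
      also have "\<dots> \<le> norm (x - z) + norm (y - w)"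
        by (metis add_diff_add norm_triangle_ineq)
      finally show "infdist (x + y) Z \<le> infdist x Z + infdist y Z + e" using zw by simp
    qed
  next
    fix c :: real and x
    assume c: "0 < c"
    show "infdist (c *\<^sub>R x) Z \<le> c * infdist x Z"
    proof (rule field_le_epsilon)
      fix e :: real assume "0 < e"
      then obtain z where z: "z \<in> Z" "norm (x - z) < infdist x Z + e / c"
        using near[of "e / c"] c by (meson divide_pos_pos)
      have "infdist (c *\<^sub>R x) Z \<le> norm (c *\<^sub>R x - c *\<^sub>R z)"
        using le subspace_scale[OF Z] z by blast
      also have "\<dots> = c * norm (x - z)"
        using c by (simp flip: scaleR_diff_right)
      also have "\<dots> \<le> c * (infdist x Z + e / c)"
        using z c by (intro mult_left_mono) auto
      also have "\<dots> = c * infdist x Z + e"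
        using c by (simp add: distrib_left)
      finally show "infdist (c *\<^sub>R x) Z \<le> c * infdist x Z + e" .
    qed
  next
    show "infdist 0 Z = 0" using subspace_0[OF Z] by simp
  qed
qed

text \<open>A linear functional dominated by the distance to \<open>Z\<close> vanishes on \<open>Z\<close> and has norm at most \<open>1\<close>;
  the one that agrees with this distance at \<open>x\<close> is positive there because \<open>Z\<close> is closed.\<close>

lemma closed_subspace_separation:
  fixes Z :: "'a::real_normed_vector set"
  assumes Z: "subspace Z" "closed Z" and x: "x \<notin> Z"
  obtains f :: "'a \<Rightarrow>\<^sub>L real" where "\<And>z. z \<in> Z \<Longrightarrow> blinfun_apply f z = 0" "blinfun_apply f x > 0"
proof -
  have Z0: "0 \<in> Z" using subspace_0[OF Z(1)] .
  obtain g where g: "linear g" "\<And>y. g y \<le> infdist y Z" "g x = infdist x Z"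
    using hahn_banach_sublinear[OF sublinear_infdist_subspace[OF Z(1)]] by blast
  have le: "g y \<le> norm y" for y
    using g(2)[of y] infdist_le[OF Z0, of y] by simp
  have "\<bar>g y\<bar> \<le> norm y" for y
    using le[of y] le[of "- y"] linear_neg[OF g(1), of y] by simp
  then have bl: "bounded_linear g"
    using g(1) by (auto simp: bounded_linear_def bounded_linear_axioms_def intro!: exI[of _ 1])
  have zero: "g z = 0" if "z \<in> Z" for z
    using g(2)[of z] g(2)[of "- z"] linear_neg[OF g(1), of z] that subspace_neg[OF Z(1) that] by simp
  have "g x > 0"
    using g(3) infdist_pos_not_in_closed[OF Z(2) _ x] Z0 by auto
  then show thesis
    using that[of "Blinfun g"] zero by (simp add: bounded_linear_Blinfun_apply[OF bl])
qed


section \<open>Weakly closed sets\<close>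

lemma openin_weak_topology_vimage:
  fixes f :: "'a::real_normed_vector \<Rightarrow>\<^sub>L real"
  assumes "open U"
  shows "openin weak_topology (blinfun_apply f -` U)"
  unfolding weak_topology_def
  by (rule topology_generated_by_Basis, rule CollectI, rule exI[of _ f], rule exI[of _ U]) (simp add: assms)

lemma topspace_weak_topology [simp]: "topspace weak_topology = UNIV"
  using openin_subset[OF openin_weak_topology_vimage[OF open_UNIV, of 0]]
  by (simp add: top.extremum_unique)

lemma closedin_weak_topology_vimage:
  fixes f :: "'a::real_normed_vector \<Rightarrow>\<^sub>L real"
  assumes "closed C"
  shows "closedin weak_topology (blinfun_apply f -` C)"
proof -
  have "topspace weak_topology - blinfun_apply f -` C = blinfun_apply f -` (- C)"
    by auto
  then show ?thesis
    using openin_weak_topology_vimage[of "- C" f] assms by (simp add: closedin_def open_Compl)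
qed

text \<open>By separation, a closed subspace is the intersection of the kernels of the functionals that vanish
  on it.\<close>

lemma closedin_weak_topology_closed_subspace:
  fixes Z :: "'a::real_normed_vector set"
  assumes Z: "subspace Z" "closed Z"
  shows "closedin weak_topology Z"
proof -
  let ?F = "{f :: 'a \<Rightarrow>\<^sub>L real. \<forall>z\<in>Z. blinfun_apply f z = 0}"
  have "(\<Inter>f\<in>?F. blinfun_apply f -` {0}) \<subseteq> Z"
  proof
    fix x assume x: "x \<in> (\<Inter>f\<in>?F. blinfun_apply f -` {0})"
    show "x \<in> Z"
    proof (rule ccontr)
      assume "x \<notin> Z"
      then obtain f :: "'a \<Rightarrow>\<^sub>L real"
        where "\<And>z. z \<in> Z \<Longrightarrow> blinfun_apply f z = 0" "blinfun_apply f x > 0"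
        using closed_subspace_separation[OF Z] by metis
      then show False using x by fastforce
    qed
  qed
  then have "Z = (\<Inter>f\<in>?F. blinfun_apply f -` {0})"
    by blast
  moreover have "closedin weak_topology (\<Inter>f\<in>?F. blinfun_apply f -` {0::real})"
  proof (rule closedin_Inter)
    have "0 \<in> ?F" by simp
    then show "(\<lambda>f. blinfun_apply f -` {0}) ` ?F \<noteq> {}" by blast
  qed (auto intro: closedin_weak_topology_vimage)
  ultimately show ?thesis by simp
qed


section \<open>Expansions with respect to a basic sequence\<close>

text \<open>Meaningful for \<open>y\<close> in the closed span of a basic sequence, where the expansion is unique.\<close>

definition coords :: "(nat \<Rightarrow> 'a::real_normed_vector) \<Rightarrow> 'a \<Rightarrow> nat \<Rightarrow> real" where
  "coords e y = (THE c. (\<lambda>n. c n *\<^sub>R e n) sums y)"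

definition partial_sum :: "(nat \<Rightarrow> 'a::real_normed_vector) \<Rightarrow> nat \<Rightarrow> 'a \<Rightarrow> 'a" where
  "partial_sum e n y = (\<Sum>k<n. coords e y k *\<^sub>R e k)"

lemma subspace_closure_subspace:
  fixes V :: "'a::real_normed_vector set"
  assumes V: "subspace V"
  shows "subspace (closure V)"
proof (rule subspaceI)
  show "0 \<in> closure V" using subspace_0[OF V] closure_subset by blast
next
  fix x y assume "x \<in> closure V" "y \<in> closure V"
  then obtain a b where "\<And>n. a n \<in> V" "a \<longlonglongrightarrow> x" "\<And>n. b n \<in> V" "b \<longlonglongrightarrow> y"
    unfolding closure_sequential by blast
  then show "x + y \<in> closure V"
    unfolding closure_sequential
    by (intro exI[of _ "\<lambda>n. a n + b n"]) (auto intro: tendsto_add subspace_add[OF V])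
next
  fix c :: real and x assume "x \<in> closure V"
  then obtain a where "\<And>n. a n \<in> V" "a \<longlonglongrightarrow> x"
    unfolding closure_sequential by blast
  then show "c *\<^sub>R x \<in> closure V"
    unfolding closure_sequential
    by (intro exI[of _ "\<lambda>n. c *\<^sub>R a n"]) (auto intro: tendsto_scaleR subspace_scale[OF V])
qed

locale basic_seq =
  fixes e :: "nat \<Rightarrow> 'a::banach"
  assumes basic: "basic_sequence e"
begin

abbreviation Y :: "'a set" where "Y \<equiv> closure (span (range e))"
abbreviation S :: "nat \<Rightarrow> 'a \<Rightarrow> 'a" where "S \<equiv> partial_sum e"

lemma subspace_Y: "subspace Y"
  by (rule subspace_closure_subspace) simp

lemma expansion_unique_exists: "y \<in> Y \<Longrightarrow> \<exists>!c. (\<lambda>n. c n *\<^sub>R e n) sums y"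
  using basic by (simp add: basic_sequence_def schauder_basis_of_def)

lemma coords_sums: "y \<in> Y \<Longrightarrow> (\<lambda>n. coords e y n *\<^sub>R e n) sums y"
  unfolding coords_def using theI'[OF expansion_unique_exists] .

lemma coords_eqI: "y \<in> Y \<Longrightarrow> (\<lambda>n. c n *\<^sub>R e n) sums y \<Longrightarrow> coords e y = c"
  using expansion_unique_exists coords_sums by blast

lemma partial_sum_tendsto: "y \<in> Y \<Longrightarrow> (\<lambda>n. S n y) \<longlonglongrightarrow> y"
  using coords_sums[of y] by (simp add: partial_sum_def sums_def)

lemma e_in_Y: "e n \<in> Y"
  by (meson closure_subset rangeI span_base subsetD)

lemma coords_add:
  assumes "x \<in> Y" "y \<in> Y"
  shows "coords e (x + y) = (\<lambda>n. coords e x n + coords e y n)"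
  using sums_add[OF coords_sums[OF assms(1)] coords_sums[OF assms(2)]] assms
  by (intro coords_eqI subspace_add[OF subspace_Y]) (simp_all add: scaleR_add_left)

lemma coords_scaleR:
  assumes "y \<in> Y"
  shows "coords e (c *\<^sub>R y) = (\<lambda>n. c * coords e y n)"
  using sums_scaleR_right[OF coords_sums[OF assms], of c] assms
  by (intro coords_eqI subspace_scale[OF subspace_Y]) simp_all

lemma partial_sum_add: "x \<in> Y \<Longrightarrow> y \<in> Y \<Longrightarrow> S n (x + y) = S n x + S n y"
  by (simp add: partial_sum_def coords_add scaleR_add_left sum.distrib)

lemma partial_sum_scaleR: "y \<in> Y \<Longrightarrow> S n (c *\<^sub>R y) = c *\<^sub>R S n y"
  by (simp add: partial_sum_def coords_scaleR scaleR_sum_right)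

lemma partial_sum_diff: "x \<in> Y \<Longrightarrow> y \<in> Y \<Longrightarrow> S n (x - y) = S n x - S n y"
  using partial_sum_add[of x "(-1) *\<^sub>R y" n] partial_sum_scaleR[of y n "-1"]
    subspace_scale[OF subspace_Y, of y "-1"] by simp

lemma sums_single_term: "(\<lambda>k. (if k = n then 1 else 0) *\<^sub>R e k) sums e n"
  using sums_single[of n e] by (simp add: if_distrib[of "\<lambda>c. c *\<^sub>R _"] cong: if_cong)

lemma e_nonzero: "e n \<noteq> 0"
proof
  assume "e n = 0"
  then have "(\<lambda>k. (if k = n then 1 else 0) *\<^sub>R e k) sums 0" "(\<lambda>k. 0 *\<^sub>R e k) sums 0" "0 \<in> Y"
    using sums_single_term[of n] e_in_Y[of n] by simp_all
  then have "coords e 0 = (\<lambda>k. if k = n then 1 else 0)" "coords e 0 = (\<lambda>k. 0)"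
    by (blast intro: coords_eqI)+
  then have "(1::real) = 0" by (auto dest: fun_cong[where x = n])
  then show False by simp
qed

lemma partial_sum_zero_on_tail:
  assumes "y \<in> span (e ` {n..})"
  shows "S n y = 0"
proof -
  have "e ` {n..} \<subseteq> {y \<in> Y. S n y = 0}"
  proof
    fix z assume "z \<in> e ` {n..}"
    then obtain k where k: "n \<le> k" "z = e k" by auto
    have "coords e (e k) = (\<lambda>j. if j = k then 1 else 0)"
      by (rule coords_eqI[OF e_in_Y sums_single_term])
    then have "S n (e k) = 0"
      using k by (auto simp: partial_sum_def intro!: sum.neutral)
    then show "z \<in> {y \<in> Y. S n y = 0}" using k e_in_Y by simp
  qed
  moreover have "subspace {y \<in> Y. S n y = 0}"
  proof (rule subspaceI)
    show "0 \<in> {y \<in> Y. S n y = 0}"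
      using subspace_0[OF subspace_Y] partial_sum_scaleR[of 0 n 0] by simp
  qed (use subspace_add[OF subspace_Y] subspace_scale[OF subspace_Y] in
      \<open>simp_all add: partial_sum_add partial_sum_scaleR\<close>)
  ultimately show ?thesis using assms span_minimal by blast
qed

section \<open>Uniform boundedness of the partial sum operators\<close>

definition bounded_sums :: "real \<Rightarrow> 'a set" where
  "bounded_sums K = {y \<in> Y. \<forall>n. norm (S n y) \<le> K}"

lemma bounded_sums_scaleR: "y \<in> bounded_sums K \<Longrightarrow> 0 \<le> c \<Longrightarrow> c *\<^sub>R y \<in> bounded_sums (c * K)"
  using subspace_scale[OF subspace_Y] by (auto simp: bounded_sums_def partial_sum_scaleR mult_left_mono)

text \<open>Half-differences move a ball around some point to the origin.\<close>

lemma bounded_sums_midpoint: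
  assumes "x \<in> bounded_sums K" "y \<in> bounded_sums K"
  shows "(1/2) *\<^sub>R (x - y) \<in> bounded_sums K"
proof -
  have xy: "x \<in> Y" "y \<in> Y" "x - y \<in> Y"
    using assms subspace_diff[OF subspace_Y] by (auto simp: bounded_sums_def)
  have "norm (S n ((1/2) *\<^sub>R (x - y))) \<le> K" for n
  proof -
    have "norm (S n ((1/2) *\<^sub>R (x - y))) = norm (S n x - S n y) / 2"
      using xy by (simp add: partial_sum_scaleR partial_sum_diff)
    also have "\<dots> \<le> (norm (S n x) + norm (S n y)) / 2"
      by (simp add: norm_triangle_ineq4)
    also have "\<dots> \<le> K"
    proof -
      have "norm (S n x) \<le> K" "norm (S n y) \<le> K"
        using assms by (simp_all add: bounded_sums_def)
      then show ?thesis by simp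
    qed
    finally show ?thesis .
  qed
  then show ?thesis
    using xy subspace_scale[OF subspace_Y] by (simp add: bounded_sums_def)
qed

text \<open>Expansions converge, so their partial sums are bounded and \<open>Y\<close> is the union of the sets
  \<open>bounded_sums k\<close>. By Baire's theorem the closure of one of them contains a ball of \<open>Y\<close> around some
  \<open>z\<close>; the points \<open>z + y\<close> and \<open>z - y\<close> then have half-difference \<open>y\<close>.\<close>

lemma ball_subset_closure_bounded_sums:
  obtains K r where "0 \<le> K" "0 < r" "Y \<inter> ball 0 r \<subseteq> closure (bounded_sums K)"
proof -
  have clA: "closure (bounded_sums K) \<subseteq> Y" for K
    by (rule closure_minimal) (auto simp: bounded_sums_def)
  have "\<exists>k::nat. y \<in> bounded_sums (real k)" if y: "y \<in> Y" for y
  proof -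
    have "Bseq (\<lambda>n. S n y)"
      by (rule convergent_imp_Bseq[OF convergentI[OF partial_sum_tendsto[OF y]]])
    then obtain B where B: "\<And>n. norm (S n y) \<le> B" unfolding Bseq_def by metis
    obtain k :: nat where k: "B \<le> real k" using real_arch_simple by metis
    have "norm (S n y) \<le> real k" for n using B[of n] k by simp
    then show ?thesis using y by (auto simp: bounded_sums_def)
  qed
  have cover: "(\<Union>k::nat. closure (bounded_sums (real k))) = Y"
  proof (intro equalityI subsetI UN_least)
    fix y assume "y \<in> Y"
    then obtain k :: nat where "y \<in> bounded_sums (real k)"
      using \<open>\<And>y. y \<in> Y \<Longrightarrow> \<exists>k::nat. y \<in> bounded_sums (real k)\<close> by metis
    then show "y \<in> (\<Union>k::nat. closure (bounded_sums (real k)))"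
      using closure_subset by blast
  qed (use clA in blast)
  have compl: "completely_metrizable_space (top_of_set Y)"
    by (rule completely_metrizable_space_closedin[OF completely_metrizable_space_euclidean])
      (simp flip: closed_closedin)
  have "\<exists>k::nat. (top_of_set Y) interior_of (closure (bounded_sums (real k))) \<noteq> {}"
  proof (rule ccontr)
    assume "\<not> ?thesis"
    then have "(top_of_set Y) interior_of (\<Union>(range (\<lambda>k::nat. closure (bounded_sums (real k))))) = {}"
      using clA by (intro Baire_category_alt disjI1 compl) (auto simp: closed_subset)
    then have "Y = {}"
      unfolding cover by (metis interior_of_topspace topspace_euclidean_subtopology)
    then show False using e_in_Y[of 0] by simp
  qed
  then obtain k :: nat and z where "z \<in> (top_of_set Y) interior_of (closure (bounded_sums (real k)))"
    by (meson ex_in_conv)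
  then obtain T where T: "openin (top_of_set Y) T" "z \<in> T" "T \<subseteq> closure (bounded_sums (real k))"
    unfolding interior_of_def by (elim CollectE exE conjE)
  then obtain r where r: "0 < r" "ball z r \<inter> Y \<subseteq> T" and z: "z \<in> Y"
    unfolding openin_contains_ball by (meson subsetD)
  have "y \<in> closure (bounded_sums (real k))" if y: "y \<in> Y" "norm y < r" for y
  proof -
    have "z + y \<in> ball z r \<inter> Y" "z - y \<in> ball z r \<inter> Y"
      using y subspace_add[OF subspace_Y z y(1)] subspace_diff[OF subspace_Y z y(1)]
      by (simp_all add: dist_norm)
    then have "z + y \<in> closure (bounded_sums (real k))" "z - y \<in> closure (bounded_sums (real k))"
      using subset_trans[OF r(2) T(3)] by (simp_all only: subsetD)
    then obtain a b where ab: "\<And>n. a n \<in> bounded_sums (real k)" "a \<longlonglongrightarrow> z + y"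
        "\<And>n. b n \<in> bounded_sums (real k)" "b \<longlonglongrightarrow> z - y"
      unfolding closure_sequential by metis
    have "(\<lambda>n. (1/2) *\<^sub>R (a n - b n)) \<longlonglongrightarrow> (1/2) *\<^sub>R ((z + y) - (z - y))"
      by (intro tendsto_intros ab)
    also have "(1/2) *\<^sub>R ((z + y) - (z - y)) = y"
      by (simp flip: scaleR_2)
    finally show ?thesis
      unfolding closure_sequential
      by (intro exI[of _ "\<lambda>n. (1/2) *\<^sub>R (a n - b n)"] conjI allI bounded_sums_midpoint ab)
  qed
  then have "Y \<inter> ball 0 r \<subseteq> closure (bounded_sums (real k))" by (simp add: subset_iff)
  then show thesis by (intro that[of "real k" r] r(1)) simp_all
qed

text \<open>The closure is removed as in the proof of the open mapping theorem. Approximating \<open>y\<close>, then the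
  remainder, and so on, writes \<open>y\<close> as a series of vectors \<open>a j\<close> with partial sums bounded by
  \<open>K / 2 ^ j\<close>. Summing the coordinates of the \<open>a j\<close> gives coefficients \<open>b\<close>, and dominated
  convergence shows that the expansion with coefficients \<open>b\<close> converges to \<open>y\<close>. Uniqueness
  identifies \<open>b\<close> with the coordinates of \<open>y\<close>, so that the bounds on the \<open>a j\<close> add up to \<open>2 * K\<close>.\<close>

lemma partial_sum_bounded_on_ball:
  assumes K: "0 \<le> K" and r: "0 < r" and sub: "Y \<inter> ball 0 r \<subseteq> closure (bounded_sums K)"
    and y: "y \<in> Y" "norm y < r"
  shows "norm (S n y) \<le> 2 * K"
proof -
  have approx: "\<exists>z. z \<in> Y \<and> norm z < r / 2 ^ Suc j \<and> x - z \<in> bounded_sums (K / 2 ^ j)"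
    if x: "x \<in> Y" "norm x < r / 2 ^ j" for x j
  proof -
    have "2 ^ j *\<^sub>R x \<in> Y \<inter> ball 0 r"
      using x subspace_scale[OF subspace_Y] by (simp add: field_simps)
    then have "2 ^ j *\<^sub>R x \<in> closure (bounded_sums K)" using sub by blast
    then obtain a where a: "a \<in> bounded_sums K" "dist a (2 ^ j *\<^sub>R x) < r / 2"
      using r by (meson closure_approachable half_gt_zero)
    define b where "b = inverse (2 ^ j) *\<^sub>R a"
    have b: "b \<in> bounded_sums (K / 2 ^ j)"
      using bounded_sums_scaleR[OF a(1), of "inverse (2 ^ j)"] by (simp add: b_def field_simps)
    have "x - b = inverse (2 ^ j) *\<^sub>R (2 ^ j *\<^sub>R x - a)"
      by (simp add: b_def scaleR_diff_right)
    then have "norm (x - b) = dist a (2 ^ j *\<^sub>R x) / 2 ^ j"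
      by (simp add: dist_norm norm_minus_commute divide_inverse)
    also have "\<dots> < r / 2 ^ Suc j"
      using a(2) by (simp add: field_simps)
    finally show ?thesis
      using b x subspace_diff[OF subspace_Y] by (intro exI[of _ "x - b"]) (auto simp: bounded_sums_def)
  qed
  \<comment> \<open>\<open>R j\<close> is the remainder left after \<open>j\<close> approximation steps\<close>
  have "\<exists>R. \<forall>j. (R j \<in> Y \<and> norm (R j) < r / 2 ^ j \<and> (j = 0 \<longrightarrow> R j = y)) \<and>
      R j - R (Suc j) \<in> bounded_sums (K / 2 ^ j)"
    by (rule dependent_nat_choice) (use y approx in \<open>auto\<close>)
  then obtain R where R: "\<And>j. R j \<in> Y" "\<And>j. norm (R j) < r / 2 ^ j" "R 0 = y"
      "\<And>j. R j - R (Suc j) \<in> bounded_sums (K / 2 ^ j)"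
    by blast
  define a where "a j = R j - R (Suc j)" for j
  have aY: "a j \<in> Y" and Sa: "norm (S m (a j)) \<le> K * (1/2) ^ j" for j m
    using R(4)[of j] by (auto simp: a_def bounded_sums_def power_divide)
  have geom: "summable (\<lambda>j. c * (1/2) ^ j)" for c :: real
    by (intro summable_mult summable_geometric) simp
  have na: "norm (a j) \<le> (2 * r) * (1/2) ^ j" for j
  proof -
    have "norm (a j) \<le> norm (R j) + norm (R (Suc j))"
      unfolding a_def by (rule norm_triangle_ineq4)
    also have "\<dots> \<le> r / 2 ^ j + r / 2 ^ Suc j"
      using R(2) by (intro add_mono less_imp_le)
    also have "\<dots> \<le> (2 * r) * (1/2) ^ j"
      using r by (simp add: field_simps)
    finally show ?thesis .
  qed
  have "(\<lambda>j. r * (1/2) ^ j) \<longlonglongrightarrow> 0"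
    using summable_LIMSEQ_zero[OF geom] .
  then have "R \<longlonglongrightarrow> 0"
  proof (rule Lim_null_comparison[rotated])
    have "norm (R j) \<le> r * (1/2) ^ j" for j
      using R(2)[of j] by (simp add: power_divide)
    then show "\<forall>\<^sub>F j in sequentially. norm (R j) \<le> r * (1/2) ^ j" by simp
  qed
  from telescope_sums'[OF this] have a_sums: "a sums y"
    using R(3) by (simp add: a_def[abs_def])
  have sumS: "summable (\<lambda>j. S m (a j))" for m
    by (rule summable_comparison_test'[OF geom[of K], of 0]) (use Sa in auto)
  \<comment> \<open>the \<open>k\<close>-th term of an expansion is a difference of consecutive partial sums, and \<open>e k \<noteq> 0\<close>\<close>
  have coord_summable: "summable (\<lambda>j. coords e (a j) k)" for k
  proof (rule summable_comparison_test'[OF geom[of "2 * K / norm (e k)"], of 0])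
    fix j
    have "coords e (a j) k *\<^sub>R e k = S (Suc k) (a j) - S k (a j)"
      by (simp add: partial_sum_def)
    then have "\<bar>coords e (a j) k\<bar> * norm (e k) = norm (S (Suc k) (a j) - S k (a j))"
      by (metis norm_scaleR)
    also have "\<dots> \<le> norm (S (Suc k) (a j)) + norm (S k (a j))"
      by (rule norm_triangle_ineq4)
    also have "\<dots> \<le> 2 * K * (1/2) ^ j"
      using Sa[of "Suc k" j] Sa[of k j] by simp
    finally show "norm (coords e (a j) k) \<le> 2 * K / norm (e k) * (1/2) ^ j"
      using e_nonzero[of k] by (simp add: field_simps)
  qed
  define b where "b k = (\<Sum>j. coords e (a j) k)" for k
  have b_sum: "(\<Sum>k<m. b k *\<^sub>R e k) = (\<Sum>j. S m (a j))" for m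
  proof -
    have "(\<lambda>j. \<Sum>k<m. coords e (a j) k *\<^sub>R e k) sums (\<Sum>k<m. b k *\<^sub>R e k)"
      unfolding b_def by (intro sums_sum sums_scaleR_left summable_sums coord_summable)
    then show ?thesis by (simp add: sums_iff partial_sum_def)
  qed
  have err: "norm (a j - S m (a j)) \<le> (2 * r + K) * (1/2) ^ j" for j m
    using norm_triangle_ineq4[of "a j" "S m (a j)"] na[of j] Sa[of m j]
    by (simp add: distrib_right)
  have err_summable: "summable (\<lambda>j. norm (a j - S m (a j)))" for m
    by (rule summable_comparison_test'[OF geom[of "2 * r + K"], of 0]) (use err in auto)
  \<comment> \<open>each summand tends to zero, with a geometric majorant independent of \<open>m\<close>\<close>
  have "(\<lambda>m. \<Sum>j. norm (a j - S m (a j))) \<longlonglongrightarrow> (\<Sum>j. 0)"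
  proof (rule tannerys_theorem[THEN conjunct2, THEN conjunct2])
    show "(\<lambda>m. norm (a j - S m (a j))) \<longlonglongrightarrow> 0" for j
      using tendsto_norm[OF tendsto_diff[OF tendsto_const[of "a j"] partial_sum_tendsto[OF aY[of j]]]]
      by simp
    show "\<forall>\<^sub>F (j, m) in sequentially \<times>\<^sub>F sequentially.
        norm (norm (a j - S m (a j))) \<le> (2 * r + K) * (1/2) ^ j"
      using err by (simp add: case_prod_unfold)
  qed (use geom in auto)
  then have err_lim: "(\<lambda>m. \<Sum>j. norm (a j - S m (a j))) \<longlonglongrightarrow> 0" by simp
  have "norm (y - (\<Sum>k<m. b k *\<^sub>R e k)) \<le> (\<Sum>j. norm (a j - S m (a j)))" for m
  proof -
    have "(\<lambda>j. a j - S m (a j)) sums (y - (\<Sum>j. S m (a j)))"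
      by (intro sums_diff a_sums summable_sums sumS)
    then show ?thesis
      using summable_norm[OF err_summable[of m]] b_sum[of m] by (simp add: sums_iff)
  qed
  then have "(\<lambda>m. y - (\<Sum>k<m. b k *\<^sub>R e k)) \<longlonglongrightarrow> 0"
    by (intro Lim_null_comparison[OF _ err_lim]) simp
  from tendsto_diff[OF tendsto_const[of y] this] have "(\<lambda>k. b k *\<^sub>R e k) sums y"
    by (simp add: sums_def)
  then have "coords e y = b" by (rule coords_eqI[OF y(1)])
  then have "norm (S n y) = norm (\<Sum>j. S n (a j))"
    using b_sum by (simp add: partial_sum_def)
  also have "\<dots> \<le> (\<Sum>j. K * (1/2) ^ j)"
    by (rule norm_suminf_le[OF Sa geom])
  also have "\<dots> = 2 * K"
    by (simp add: suminf_mult summable_geometric suminf_geometric)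
  finally show ?thesis .
qed

text \<open>Banach's theorem on the basis constant: by homogeneity, a bound on one ball suffices.\<close>

theorem partial_sum_uniformly_bounded:
  obtains C where "\<And>y n. y \<in> Y \<Longrightarrow> norm (S n y) \<le> C * norm y"
proof -
  obtain K r where Kr: "0 \<le> K" "0 < r" "Y \<inter> ball 0 r \<subseteq> closure (bounded_sums K)"
    using ball_subset_closure_bounded_sums by blast
  have "norm (S n y) \<le> (4 * K / r) * norm y" if y: "y \<in> Y" for y n
  proof (cases "y = 0")
    case True
    then show ?thesis using partial_sum_scaleR[OF y, of n 0] by simp
  next
    case False
    define c where "c = r / (2 * norm y)"
    have c: "0 < c" using False Kr(2) by (simp add: c_def)
    have "norm (c *\<^sub>R y) < r" using False Kr(2) by (simp add: c_def)
    then have "norm (S n (c *\<^sub>R y)) \<le> 2 * K"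
      using partial_sum_bounded_on_ball[OF Kr] subspace_scale[OF subspace_Y y] by blast
    then have "c * norm (S n y) \<le> 2 * K"
      using c by (simp add: partial_sum_scaleR[OF y])
    then show ?thesis using False Kr(2) by (simp add: c_def field_simps)
  qed
  then show thesis by (rule that)
qed

text \<open>The \<open>n\<close>-th partial sum operator vanishes on \<open>span (e ` {n..})\<close>, hence by continuity at \<open>x\<close>. So every
  partial sum of the expansion of \<open>x\<close> is zero.\<close>

theorem tail_spans_intersect_trivially:
  assumes x: "\<And>n. x \<in> closure (span (e ` {n..}))"
  shows "x = 0"
proof -
  obtain C where C: "\<And>y n. y \<in> Y \<Longrightarrow> norm (S n y) \<le> C * norm y"
    using partial_sum_uniformly_bounded by blast
  have tail: "span (e ` {n..}) \<subseteq> Y" for n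
    using span_mono[OF image_mono[OF subset_UNIV]] closure_subset by (rule order_trans)
  have xY: "x \<in> Y"
    using x[of 0] by (simp add: atLeast_0)
  have "S n x = 0" for n
  proof -
    obtain y where y: "\<And>i. y i \<in> span (e ` {n..})" "y \<longlonglongrightarrow> x"
      using x[of n] unfolding closure_sequential by metis
    have "norm (S n x) \<le> C * norm (x - y i)" for i
      using C[of "x - y i" n] y(1)[of i] tail[of n] xY subspace_diff[OF subspace_Y]
        partial_sum_diff[OF xY, of "y i" n] partial_sum_zero_on_tail[OF y(1)] by auto
    moreover have "(\<lambda>i. C * norm (x - y i)) \<longlonglongrightarrow> C * norm (x - x)"
      by (intro tendsto_intros y)
    ultimately have "norm (S n x) \<le> C * norm (x - x)"
      by (intro LIMSEQ_le_const) auto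
    then show ?thesis by simp
  qed
  then show ?thesis
    using partial_sum_tendsto[OF xY] by (simp add: LIMSEQ_const_iff)
qed

end


section \<open>Reflexive cones with a bounded base\<close>

theorem theorem4p7:
  fixes P :: "'a::banach set"
  assumes "reflexive_cone P"
    and "\<exists>x' :: 'a \<Rightarrow>\<^sub>L real. has_bounded_base_by P x'"
  shows "\<not> contains_basic_sequence P"
proof
  assume "contains_basic_sequence P"
  then obtain e where "basic_sequence e" and eP: "range e \<subseteq> P"
    by (auto simp: contains_basic_sequence_def)
  then interpret basic_seq e by unfold_locales
  obtain f :: "'a \<Rightarrow>\<^sub>L real" where pos: "strictly_positive_on P f" and bdd: "bounded (cone_base P f)"
    using assms(2) by (auto simp: has_bounded_base_by_def)
  have cone: "convex_cone P" and comp: "compactin weak_topology (P \<inter> cball 0 1)"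
    using assms(1) by (auto simp: reflexive_cone_def)
  obtain M where M: "0 < M" "\<And>x. x \<in> cone_base P f \<Longrightarrow> norm x \<le> M"
    using bdd unfolding bounded_pos by metis
  have eP': "e n \<in> P" for n
    using eP by blast
  have fe: "0 < f (e n)" for n
    using pos eP'[of n] e_nonzero[of n] by (auto simp: strictly_positive_on_def)
  define w where "w n = (1 / (M * f (e n))) *\<^sub>R e n" for n
  have w_ball: "w n \<in> P \<inter> cball 0 1" for n
  proof -
    have "(1 / f (e n)) *\<^sub>R e n \<in> cone_base P f"
      using fe[of n] convex_cone_scaleR[OF cone _ eP', of "1 / f (e n)"]
      by (simp add: cone_base_def blinfun.scaleR_right)
    then have "norm ((1 / f (e n)) *\<^sub>R e n) \<le> M" by (rule M(2))
    then have "norm (w n) \<le> 1"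
      using fe[of n] M(1) by (simp add: w_def field_simps)
    moreover have "w n \<in> P"
      unfolding w_def using fe[of n] M(1) by (intro convex_cone_scaleR[OF cone] eP') simp
    ultimately show ?thesis by simp
  qed
  have fw: "f (w n) = 1 / M" for n
    using fe[of n] by (simp add: w_def blinfun.scaleR_right)
  \<comment> \<open>nested weakly closed sets; \<open>C n\<close> contains every \<open>w k\<close> with \<open>k \<ge> n\<close> and hence
    all weak cluster points of \<open>w\<close>\<close>
  define C where "C n = closure (span (e ` {n..})) \<inter> blinfun_apply f -` {1 / M}" for n
  have closed_C: "closedin weak_topology (C n)" for n
    unfolding C_def
    by (intro closedin_Int closedin_weak_topology_closed_subspace closedin_weak_topology_vimage
        subspace_closure_subspace) auto
  have w_C: "w n \<in> C m" if "m \<le> n" for m n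
  proof -
    have "w n \<in> span (e ` {m..})"
      unfolding w_def using that by (intro span_scale span_base) auto
    then show ?thesis
      using closure_subset[of "span (e ` {m..})"] fw by (auto simp: C_def)
  qed
  have "P \<inter> cball 0 1 \<inter> \<Inter>\<F> \<noteq> {}" if \<F>: "finite \<F>" "\<F> \<subseteq> range C" for \<F>
  proof -
    obtain I where I: "finite I" "\<F> = C ` I"
      using finite_subset_image[OF \<F>] by metis
    then obtain n where "\<And>i. i \<in> I \<Longrightarrow> i \<le> n"
      using finite_nat_set_iff_bounded_le by metis
    then have "w n \<in> P \<inter> cball 0 1 \<inter> \<Inter>\<F>"
      using w_ball[of n] w_C I(2) by auto
    then show ?thesis by blast
  qed
  then have "P \<inter> cball 0 1 \<inter> \<Inter>(range C) \<noteq> {}"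
    using comp closed_C unfolding compactin_fip by (metis rangeE)
  then obtain x where x: "\<And>n. x \<in> C n"
    by blast
  then have "x = 0"
    by (intro tail_spans_intersect_trivially) (simp add: C_def)
  moreover have "f x = 1 / M"
    using x[of 0] by (simp add: C_def)
  ultimately show False
    using M(1) by simp
qed

end
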